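(* Let $n\ge1$, let $$M=\begin{pmatrix}A&b\\ c^{\mathsf T}&d\end{pmatrix}\in\operatorname{GL}(n+1,\mathbb{R}),\qquad q(x)=c^{\mathsf T}x+d,$$ with $A$ an $n\times n$ matrix, $b,c\in\mathbb{R}^n$, $d\in\mathbb{R}$, and let $U\subset\mathbb{R}^n$ be a non-empty open set on which $q$ does not vanish. Define $$T(x)=\frac{Ax+b}{q(x)}\quad(x\in U),\qquad V=T(U).$$ Then $T:U\to V$ is invertible and the inverse map $T^{-1}:V\to U$ is the projective transformation induced by $M^{-1}$. For every non-empty compact $K\subset U$ there is a constant $C\ge1$, depending only on $n,M,K$, such that $$C^{-1}N(F;\delta)\le N(T(F);\delta)\le C\,N(F;\delta)\qquad(\delta\in\Delta_n)$$ for every non-empty $F\subseteq K$. Consequently, for every such $F$, $$\underline{\mathrm P}(T(F))=\underline{\mathrm P}(F),\qquad \overline{\mathrm P}(T(F))=\overline{\mathrm P}(F).$$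
   Context: The projective transformation induced by a matrix $\begin{pmatrix}\widehat A&\widehat b\\ \widehat c^{\mathsf T}&\widehat d\end{pmatrix}\in\operatorname{GL}(n+1,\mathbb{R})$ is the map $z\mapsto(\widehat Az+\widehat b)/(\widehat c^{\mathsf T}z+\widehat d)$, defined where the denominator is non-zero. An open box in $\mathbb{R}^n$ is an open rectangular box with positive side lengths and arbitrary orientation; its side lengths in decreasing order are $l_1(B)\ge\cdots\ge l_n(B)>0$. Let $\Delta_n=\{\delta\in(0,1)^n:\delta_1\ge\cdots\ge\delta_n\}$. For non-empty bounded $F\subset\mathbb{R}^n$ and $\delta\in\Delta_n$, $N(F;\delta)$ is the least number of open boxes $B$ needed to cover $F$, subject to $l_i(B)\le\delta_i$ for $1\le i\le n$ for every box in the cover (boxes may have different orientations). For $\alpha\in[0,\infty)^n$ write $\delta^\alpha=\prod_i\delta_i^{\alpha_i}$. The lower and upper box dimension prints are $$\underline{\mathrm P}(F)=\Bigl\{\alpha\in[0,\infty)^n:\liminf_{\delta\in\Delta_n,\,\delta_1\downarrow0}N(F;\delta)\delta^\alpha>0\Bigr\},\quad \overline{\mathrm P}(F)=\Bigl\{\alpha\in[0,\infty)^n:\limsup_{\delta\in\Delta_n,\,\delta_1\downarrow0}N(F;\delta)\delta^\alpha>0\Bigr\},$$ the limits being over all of $\Delta_n$ as $\delta_1\downarrow0$. *)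

theory Defs
  imports "HOL-Analysis.Analysis"
begin

text \<open>
  Points of \<open>n\<close>-space, tuples of side lengths, scales and exponents are all vectors of type
  \<open>real ^ 'n\<close>, where \<open>'n\<close> is an arbitrary finite linearly ordered type with \<open>n\<close> elements; the linear
  order plays the role of \<open>1 < 2 < \<dots> < n\<close>, so that the index \<open>1\<close> is \<open>Min UNIV\<close>.  The \<open>n + 1\<close> row
  and column indices of a block matrix are \<open>Inl i\<close> (\<open>i :: 'n\<close>) followed by \<open>Inr ()\<close>.
\<close>

definition block_matrix ::
    "real ^ 'n ^ 'n \<Rightarrow> real ^ 'n \<Rightarrow> real ^ 'n \<Rightarrow> real \<Rightarrow> real ^ ('n + unit) ^ ('n::finite + unit)"
  where "block_matrix A b c d =
    (\<chi> i j. case i of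
        Inl k \<Rightarrow> (case j of Inl l \<Rightarrow> A $ k $ l | Inr _ \<Rightarrow> b $ k)
      | Inr _ \<Rightarrow> (case j of Inl l \<Rightarrow> c $ l | Inr _ \<Rightarrow> d))"

definition proj_denom :: "real ^ ('n + unit) ^ ('n::finite + unit) \<Rightarrow> real ^ 'n \<Rightarrow> real"
  where "proj_denom P z = (\<chi> l. P $ Inr () $ Inl l) \<bullet> z + P $ Inr () $ Inr ()"

text \<open>The natural domain of the projective transformation induced by \<open>P\<close>; outside of it, the value
  of the total function \<open>proj_map P\<close> below is meaningless.\<close>

definition proj_dom :: "real ^ ('n + unit) ^ ('n::finite + unit) \<Rightarrow> (real ^ 'n) set"
  where "proj_dom P = {z. proj_denom P z \<noteq> 0}"

definition proj_map :: "real ^ ('n + unit) ^ ('n::finite + unit) \<Rightarrow> real ^ 'n \<Rightarrow> real ^ 'n"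
  where "proj_map P z =
    (1 / proj_denom P z) *\<^sub>R ((\<chi> k l. P $ Inl k $ Inl l) *v z + (\<chi> k. P $ Inl k $ Inr ()))"

text \<open>\<open>open_box_sides B l\<close>: the set \<open>B\<close> is an open rectangular box of arbitrary position and
  orientation whose side lengths, in decreasing order, are the entries of \<open>l\<close>.  Requiring the sides
  of the axis-parallel model box to be decreasing is no restriction, because permutations of the
  coordinates are orthogonal.\<close>

definition open_box_sides :: "(real ^ 'n::{finite,linorder}) set \<Rightarrow> real ^ 'n::{finite,linorder} \<Rightarrow> bool"
  where "open_box_sides B l \<longleftrightarrow>
    (\<forall>i. 0 < l $ i) \<and> (\<forall>i j. i \<le> j \<longrightarrow> l $ j \<le> l $ i) \<and>
    (\<exists>a Q. orthogonal_transformation Q \<and> B = (\<lambda>x. a + Q x) ` {x. \<forall>i. 0 < x $ i \<and> x $ i < l $ i})"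

definition scales :: "(real ^ 'n::{finite,linorder}) set"
  where "scales = {\<delta>. (\<forall>i. 0 < \<delta> $ i \<and> \<delta> $ i < 1) \<and> (\<forall>i j. i \<le> j \<longrightarrow> \<delta> $ j \<le> \<delta> $ i)}"

definition box_cover ::
    "(real ^ 'n::{finite,linorder}) set \<Rightarrow> real ^ 'n::{finite,linorder} \<Rightarrow>
      (real ^ 'n::{finite,linorder}) set set \<Rightarrow> bool"
  where "box_cover F \<delta> \<B> \<longleftrightarrow>
    F \<subseteq> \<Union>\<B> \<and> (\<forall>B\<in>\<B>. \<exists>l. open_box_sides B l \<and> (\<forall>i. l $ i \<le> \<delta> $ i))"

text \<open>Only meaningful for bounded \<open>F\<close>, for which finite covers exist.\<close>

definition cover_number :: "(real ^ 'n::{finite,linorder}) set \<Rightarrow> real ^ 'n::{finite,linorder} \<Rightarrow> nat"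
  where "cover_number F \<delta> = (LEAST k. \<exists>\<B>. finite \<B> \<and> card \<B> = k \<and> box_cover F \<delta> \<B>)"

definition scale_power :: "real ^ 'n \<Rightarrow> real ^ 'n \<Rightarrow> real"
  where "scale_power \<delta> \<alpha> = (\<Prod>i\<in>UNIV. (\<delta> $ i) powr (\<alpha> $ i))"

definition scales_to_zero :: "(real ^ 'n::{finite,linorder}) filter"
  where "scales_to_zero =
    inf (filtercomap (\<lambda>\<delta>. \<delta> $ Min UNIV) (at_right 0)) (principal scales)"

definition lower_print :: "(real ^ 'n::{finite,linorder}) set \<Rightarrow> (real ^ 'n::{finite,linorder}) set"
  where "lower_print F = {\<alpha>. (\<forall>i. 0 \<le> \<alpha> $ i) \<and>
    Liminf scales_to_zero (\<lambda>\<delta>. ereal (real (cover_number F \<delta>) * scale_power \<delta> \<alpha>)) > 0}"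

definition upper_print :: "(real ^ 'n::{finite,linorder}) set \<Rightarrow> (real ^ 'n::{finite,linorder}) set"
  where "upper_print F = {\<alpha>. (\<forall>i. 0 \<le> \<alpha> $ i) \<and>
    Limsup scales_to_zero (\<lambda>\<delta>. ereal (real (cover_number F \<delta>) * scale_power \<delta> \<alpha>)) > 0}"

end

theory Submission
  imports Defs
begin

text \<open>
  Write \<open>T\<close> for the transformation and \<open>q\<close> for its denominator.  The comparison of covering numbers
  rests on the identity

    \<open>T x - T x0 = (A (x - x0) - (c \<bullet> (x - x0)) T x0) / q x\<close>,

  whose numerator is linear in \<open>x - x0\<close> with a norm bounded uniformly for \<open>x0\<close> in a compact set \<open>K\<close>
  of the domain.  If \<open>x\<close> and \<open>x0\<close> lie in a common box with axes \<open>e_i\<close> and sides \<open>l_i\<close>, then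
  \<open>x - x0 = \<Sum> t_i e_i\<close> with \<open>\<bar>t_i\<bar> \<le> l_i\<close>, so \<open>T x - T x0\<close> is a combination of vectors \<open>v_i\<close> of
  bounded length that depend on \<open>x0\<close> but not on \<open>x\<close>, with coefficients at most a constant times \<open>l_i\<close>.  Orthonormalising \<open>v_1, \<dots>, v_n\<close> in
  this order gives \<open>w_1, \<dots>, w_n\<close> such that only the \<open>v_i\<close> with \<open>i \<ge> j\<close> have a component along \<open>w_j\<close>;
  as \<open>l\<close> is decreasing, that component of \<open>T x - T x0\<close> is at most a constant times \<open>l_j\<close>.  Hence the
  part of the image that comes from \<open>K\<close> lies in a box whose sides are a constant times \<open>l_j\<close>
  (lemma \<open>proj_image_box\<close>), and cutting this box up (lemma \<open>box_cover_subdivide\<close>) yields boundedly many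
  boxes with the original sides.  The constants do not depend on the box, so that one factor serves
  all scales at once.

  The inverse of \<open>T\<close> is again projective, because in homogeneous coordinates \<open>T\<close> is multiplication
  by \<open>M\<close>; applying the estimate to it on the compact set \<open>T K\<close> gives the reverse inequality.  The
  prints only see the covering numbers up to a constant factor.
\<close>

section \<open>Projective maps in homogeneous coordinates\<close>

definition hom_coords :: "real ^ 'n \<Rightarrow> real ^ ('n::finite + unit)"
  where "hom_coords x = (\<chi> i. case i of Inl k \<Rightarrow> x $ k | Inr _ \<Rightarrow> 1)"

abbreviation linear_part :: "real ^ ('n + unit) ^ ('n::finite + unit) \<Rightarrow> real ^ 'n ^ 'n"
  where "linear_part P \<equiv> (\<chi> k l. P $ Inl k $ Inl l)"

abbreviation denom_gradient :: "real ^ ('n + unit) ^ ('n::finite + unit) \<Rightarrow> real ^ 'n"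
  where "denom_gradient P \<equiv> (\<chi> l. P $ Inr () $ Inl l)"

lemma sum_UNIV_Plus_unit:
  fixes f :: "'n::finite + unit \<Rightarrow> real"
  shows "sum f UNIV = (\<Sum>l\<in>UNIV. f (Inl l)) + f (Inr ())"
proof -
  have "sum f UNIV = sum f (UNIV <+> UNIV)"
    by simp
  also have "\<dots> = (\<Sum>l\<in>UNIV. f (Inl l)) + f (Inr ())"
    by (subst sum.Plus) (simp_all add: UNIV_unit)
  finally show ?thesis .
qed

lemma matrix_mult_hom_coords_Inl:
  "(P *v hom_coords z) $ Inl k = (linear_part P *v z + (\<chi> k. P $ Inl k $ Inr ())) $ k"
  by (simp add: matrix_vector_mult_def sum_UNIV_Plus_unit hom_coords_def)

lemma matrix_mult_hom_coords_Inr: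
  "(P *v hom_coords z) $ Inr () = proj_denom P z"
  by (simp add: matrix_vector_mult_def sum_UNIV_Plus_unit hom_coords_def proj_denom_def inner_vec_def)

lemma proj_map_hom_coords:
  "proj_map P z $ k = (P *v hom_coords z) $ Inl k / proj_denom P z"
  by (simp only: matrix_mult_hom_coords_Inl) (simp add: proj_map_def)

text \<open>In homogeneous coordinates the projective map is multiplication by the matrix, up to the scalar
  that the last coordinate carries.  Products of matrices therefore induce compositions.\<close>

lemma hom_coords_proj_map:
  assumes "proj_denom P x \<noteq> 0"
  shows "P *v hom_coords x = proj_denom P x *\<^sub>R hom_coords (proj_map P x)"
proof -
  have "(P *v hom_coords x) $ i = (proj_denom P x *\<^sub>R hom_coords (proj_map P x)) $ i" for i
    using assms
    by (cases i)
      (simp_all add: proj_map_hom_coords matrix_mult_hom_coords_Inr hom_coords_def[of "proj_map P x"])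
  then show ?thesis
    by (simp add: vec_eq_iff)
qed

lemma proj_map_inverse:
  assumes "P' ** P = mat 1" and "proj_denom P x \<noteq> 0"
  shows "proj_denom P' (proj_map P x) \<noteq> 0" and "proj_map P' (proj_map P x) = x"
proof -
  let ?y = "proj_map P x"
  have "hom_coords x = P' *v (P *v hom_coords x)"
    by (simp add: matrix_vector_mul_assoc assms(1))
  then have eq: "hom_coords x = proj_denom P x *\<^sub>R (P' *v hom_coords ?y)"
    by (simp add: hom_coords_proj_map[OF assms(2)] matrix_vector_mult_scaleR)
  have one: "1 = proj_denom P x * proj_denom P' ?y"
    using arg_cong[OF eq, of "\<lambda>v. v $ Inr ()"]
    by (simp add: matrix_mult_hom_coords_Inr hom_coords_def[of x])
  then show nz: "proj_denom P' ?y \<noteq> 0"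
    by auto
  have "x $ k = proj_map P' ?y $ k" for k
  proof -
    have "x $ k = proj_denom P x * (P' *v hom_coords ?y) $ Inl k"
      using arg_cong[OF eq, of "\<lambda>v. v $ Inl k"] by (simp add: hom_coords_def[of x])
    also have "\<dots> = proj_map P' ?y $ k"
      using one nz by (simp add: proj_map_hom_coords field_simps)
    finally show ?thesis .
  qed
  then show "proj_map P' ?y = x"
    by (simp add: vec_eq_iff)
qed

lemma proj_denom_block_matrix: "proj_denom (block_matrix A b c d) x = c \<bullet> x + d"
  by (simp add: proj_denom_def block_matrix_def)

lemma proj_map_block_matrix:
  "proj_map (block_matrix A b c d) x = (1 / (c \<bullet> x + d)) *\<^sub>R (A *v x + b)"
  by (simp add: proj_map_def proj_denom_block_matrix) (simp add: block_matrix_def)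

text \<open>The constant vector of the numerator is eliminated through its value at the base point \<open>x0\<close>, which
  is \<open>proj_denom P x0 *\<^sub>R proj_map P x0\<close>.  What remains is linear in the increment, except for a scalar
  factor common to all coordinates.\<close>

lemma proj_map_diff:
  assumes "proj_denom P x \<noteq> 0" and "proj_denom P x0 \<noteq> 0"
  shows "proj_map P x - proj_map P x0 = (1 / proj_denom P x) *\<^sub>R
    (linear_part P *v (x - x0) - (denom_gradient P \<bullet> (x - x0)) *\<^sub>R proj_map P x0)"
proof -
  let ?b = "(\<chi> k. P $ Inl k $ Inr ()) :: real ^ 'a"
  have num: "linear_part P *v y = proj_denom P y *\<^sub>R proj_map P y - ?b"
    if "proj_denom P y \<noteq> 0" for y
    using that by (simp add: proj_map_def)
  have lin: "linear_part P *v (x - x0) =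
      proj_denom P x *\<^sub>R proj_map P x - proj_denom P x0 *\<^sub>R proj_map P x0"
    by (simp add: matrix_vector_mult_diff_distrib num[OF assms(1)] num[OF assms(2)])
  have den: "denom_gradient P \<bullet> (x - x0) = proj_denom P x - proj_denom P x0"
    by (simp add: proj_denom_def inner_diff_right)
  have "linear_part P *v (x - x0) - (denom_gradient P \<bullet> (x - x0)) *\<^sub>R proj_map P x0
      = proj_denom P x *\<^sub>R (proj_map P x - proj_map P x0)"
    unfolding lin den by (simp add: algebra_simps)
  then show ?thesis
    using assms(1) by simp
qed

lemma continuous_on_proj_denom: "continuous_on S (proj_denom P)"
  unfolding proj_denom_def by (intro continuous_intros)

lemma continuous_on_proj_map:
  assumes "S \<subseteq> proj_dom P"
  shows "continuous_on S (proj_map P)"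
  unfolding proj_map_def using assms
  by (intro continuous_intros continuous_on_proj_denom matrix_vector_mult_linear_continuous_on)
    (auto simp: proj_dom_def)

section \<open>Orthonormalisation along a finite linear order\<close>

text \<open>One Gram-Schmidt step.  If \<open>v\<close> already lies in the span of \<open>W\<close> there is still room for a new
  unit vector, since \<open>W\<close> does not span the space.\<close>

lemma gram_schmidt_step:
  fixes v :: "'a::euclidean_space"
  assumes "dim W < DIM('a)"
  obtains u where "norm u = 1" and "\<And>x. x \<in> span W \<Longrightarrow> u \<bullet> x = 0" and "v \<in> span (insert u W)"
proof -
  obtain y z where yz: "y \<in> span W" "\<And>w. w \<in> span W \<Longrightarrow> orthogonal z w" "v = y + z"
    using orthogonal_subspace_decomp_exists[of W v] by metis
  have "\<exists>z'. z' \<noteq> 0 \<and> (\<forall>x\<in>span W. z' \<bullet> x = 0) \<and> v \<in> span (insert z' W)"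
  proof (cases "z = 0")
    case True
    then have "v \<in> span (insert z' W)" for z'
      using yz span_mono[of W "insert z' W"] by auto
    moreover obtain z' where "z' \<noteq> 0" "\<And>x. x \<in> span W \<Longrightarrow> orthogonal z' x"
      using orthogonal_to_subspace_exists[OF assms] by blast
    ultimately show ?thesis
      by (auto simp: orthogonal_def)
  next
    case False
    have "v \<in> span (insert z W)"
      unfolding yz(3) by (intro span_add span_base subsetD[OF span_mono yz(1)]) auto
    with False yz(2) show ?thesis
      by (auto simp: orthogonal_def)
  qed
  then obtain z' where z': "z' \<noteq> 0" "\<forall>x\<in>span W. z' \<bullet> x = 0" "v \<in> span (insert z' W)"
    by blast
  have "z' = norm z' *\<^sub>R (z' /\<^sub>R norm z')"
    using z'(1) by simp
  then have "z' \<in> span (insert (z' /\<^sub>R norm z') W)"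
    by (metis insertI1 span_base span_scale)
  then have "span (insert z' W) \<subseteq> span (insert (z' /\<^sub>R norm z') W)"
    by (intro span_minimal) (auto intro: span_base)
  with z' show ?thesis
    by (intro that[of "z' /\<^sub>R norm z'"]) auto
qed

text \<open>The induction adds a new largest index, so that the flag of spans already built stays as it is.\<close>

lemma gram_schmidt_linorder:
  fixes v :: "'n::{finite,linorder} \<Rightarrow> real ^ 'n::{finite,linorder}"
  obtains w where "\<And>i. norm (w i) = 1" and "\<And>i j. i \<noteq> j \<Longrightarrow> w i \<bullet> w j = 0"
    and "\<And>i. v i \<in> span (w ` {..i})"
proof -
  have "\<exists>w. (\<forall>i\<in>I. norm (w i) = 1) \<and> (\<forall>i\<in>I. \<forall>j\<in>I. i \<noteq> j \<longrightarrow> w i \<bullet> w j = 0) \<and>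
      (\<forall>i\<in>I. v i \<in> span (w ` {k\<in>I. k \<le> i}))" if "finite I" for I :: "'n set"
    using that
  proof (induction I rule: finite_linorder_max_induct)
    case empty
    then show ?case by simp
  next
    case (insert m I)
    then obtain w where w: "\<forall>i\<in>I. norm (w i) = 1" "\<forall>i\<in>I. \<forall>j\<in>I. i \<noteq> j \<longrightarrow> w i \<bullet> w j = 0"
      "\<forall>i\<in>I. v i \<in> span (w ` {k\<in>I. k \<le> i})"
      by blast
    have "m \<notin> I"
      using insert by auto
    have "dim (w ` I) \<le> card (w ` I)"
      by (intro dim_le_card') (use insert in auto)
    also have "\<dots> \<le> card I"
      by (intro card_image_le) (use insert in auto)
    also have "\<dots> < CARD('n)"
      using \<open>m \<notin> I\<close> by (intro psubset_card_mono) auto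
    finally have "dim (w ` I) < DIM(real ^ 'n::{finite,linorder})"
      by simp
    then obtain u where u: "norm u = 1" "\<And>x. x \<in> span (w ` I) \<Longrightarrow> u \<bullet> x = 0"
      "v m \<in> span (insert u (w ` I))"
      using gram_schmidt_step[of "w ` I" "v m"] by blast
    let ?w = "w(m := u)"
    have img: "?w ` {k\<in>insert m I. k \<le> i} = w ` {k\<in>I. k \<le> i}" if "i \<in> I" for i
      using insert(2) that \<open>m \<notin> I\<close> by (intro image_cong) (auto simp: not_le)
    have "{k\<in>insert m I. k \<le> m} = insert m I"
      using insert(2) by auto
    then have imgm: "?w ` {k\<in>insert m I. k \<le> m} = insert u (w ` I)"
      using \<open>m \<notin> I\<close> by auto
    have uw: "u \<bullet> w i = 0" "w i \<bullet> u = 0" if "i \<in> I" for i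
      using u(2)[of "w i"] that by (auto simp: inner_commute span_base)
    have "\<forall>i\<in>insert m I. v i \<in> span (?w ` {k\<in>insert m I. k \<le> i})"
    proof
      fix i assume "i \<in> insert m I"
      then show "v i \<in> span (?w ` {k\<in>insert m I. k \<le> i})"
        using u(3) imgm img[of i] w(3) by (metis insertE)
    qed
    moreover have "\<forall>i\<in>insert m I. norm (?w i) = 1"
      using w(1) u(1) by auto
    moreover have "\<forall>i\<in>insert m I. \<forall>j\<in>insert m I. i \<noteq> j \<longrightarrow> ?w i \<bullet> ?w j = 0"
      using w(2) uw by auto
    ultimately show ?case
      by (intro exI[of _ ?w]) blast
  qed
  from this[of UNIV] show ?thesis
    using that by (auto simp: atMost_def)
qed

text \<open>This is the QR decomposition of the matrix with columns \<open>v i\<close>, the triangularity of \<open>R\<close> being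
  expressed by orthogonality.\<close>

lemma orthogonal_triangularisation:
  fixes v :: "'n::{finite,linorder} \<Rightarrow> real ^ 'n::{finite,linorder}"
  obtains Q :: "real ^ 'n::{finite,linorder} \<Rightarrow> real ^ 'n::{finite,linorder}" where "orthogonal_transformation Q"
    and "\<And>i j. i < j \<Longrightarrow> Q (axis j 1) \<bullet> v i = 0"
proof -
  obtain w where w: "\<And>i. norm (w i) = 1" "\<And>i j. i \<noteq> j \<Longrightarrow> w i \<bullet> w j = 0"
    "\<And>i. v i \<in> span (w ` {..i})"
    using gram_schmidt_linorder[of v] by blast
  have ww: "w i \<bullet> w j = (if i = j then 1 else 0)" for i j
    using w(1)[of i] w(2)[of i j] by (auto simp: norm_eq_1)
  define Q where "Q x = (\<Sum>i\<in>UNIV. (x $ i) *\<^sub>R w i)" for x :: "real ^ 'n::{finite,linorder}"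
  have "linear Q"
    by (intro linearI)
      (auto simp: Q_def scaleR_left_distrib sum.distrib scaleR_sum_right)
  moreover have "Q x \<bullet> Q y = x \<bullet> y" for x y
  proof -
    have "Q x \<bullet> Q y = (\<Sum>i\<in>UNIV. x $ i * y $ i)"
      by (simp add: Q_def inner_sum_left inner_sum_right ww mult.commute if_distrib cong: if_cong)
    then show ?thesis
      by (simp add: inner_vec_def)
  qed
  ultimately have orth: "orthogonal_transformation Q"
    by (simp add: orthogonal_transformation_def)
  have Qaxis: "Q (axis j 1) = w j" for j
  proof -
    have "Q (axis j 1) = (\<Sum>i\<in>UNIV. if i = j then w i else 0)"
      unfolding Q_def by (intro sum.cong) (auto simp: axis_def)
    then show ?thesis by simp
  qed
  have "Q (axis j 1) \<bullet> v i = 0" if "i < j" for i j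
  proof -
    have "orthogonal (w j) (v i)"
      using w(3)[of i]
    proof (rule orthogonal_to_span)
      fix x assume "x \<in> w ` {..i}"
      then show "orthogonal (w j) x"
        using that w(2) by (auto simp: orthogonal_def)
    qed
    then show ?thesis
      by (simp add: Qaxis orthogonal_def)
  qed
  with orth that show ?thesis by blast
qed

text \<open>In the triangular frame the coordinate \<open>j\<close> only receives contributions of size \<open>l $ i\<close> with
  \<open>i \<ge> j\<close>, and these are at most \<open>l $ j\<close>.  This is where the decreasing order of the sides matters.\<close>

lemma combination_in_oriented_box:
  fixes v :: "'n::{finite,linorder} \<Rightarrow> real ^ 'n::{finite,linorder}" and l :: "real ^ 'n::{finite,linorder}"
  assumes v: "\<And>i. norm (v i) \<le> \<gamma>"
    and l: "\<And>i. 0 < l $ i" "\<And>i j. i \<le> j \<Longrightarrow> l $ j \<le> l $ i"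
    and "0 \<le> \<rho>"
  obtains Q :: "real ^ 'n::{finite,linorder} \<Rightarrow> real ^ 'n::{finite,linorder}" where "orthogonal_transformation Q"
    and "\<forall>s. (\<forall>i. \<bar>s i\<bar> \<le> \<rho> * l $ i) \<longrightarrow>
      (\<exists>y. (\<Sum>i\<in>UNIV. s i *\<^sub>R v i) = Q y \<and> (\<forall>j. \<bar>y $ j\<bar> \<le> real CARD('n) * \<rho> * \<gamma> * l $ j))"
proof -
  obtain Q :: "real ^ 'n::{finite,linorder} \<Rightarrow> real ^ 'n::{finite,linorder}" where Q: "orthogonal_transformation Q"
    and tri: "\<And>i j. i < j \<Longrightarrow> Q (axis j 1) \<bullet> v i = 0"
    using orthogonal_triangularisation[of v] by blast
  have "\<exists>y. (\<Sum>i\<in>UNIV. s i *\<^sub>R v i) = Q y \<and> (\<forall>j. \<bar>y $ j\<bar> \<le> real CARD('n) * \<rho> * \<gamma> * l $ j)"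
    if s: "\<And>i. \<bar>s i\<bar> \<le> \<rho> * l $ i" for s
  proof -
    obtain y where y: "(\<Sum>i\<in>UNIV. s i *\<^sub>R v i) = Q y"
      using orthogonal_transformation_surj[OF Q] by (metis surjD)
    have "\<bar>y $ j\<bar> \<le> real CARD('n) * \<rho> * \<gamma> * l $ j" for j
    proof -
      have "y $ j = Q (axis j 1) \<bullet> Q y"
        using Q by (simp add: orthogonal_transformation_def inner_axis')
      also have "\<dots> = (\<Sum>i\<in>UNIV. s i * (Q (axis j 1) \<bullet> v i))"
        unfolding y[symmetric] by (simp add: inner_sum_right)
      finally have "\<bar>y $ j\<bar> \<le> (\<Sum>i\<in>UNIV. \<bar>s i * (Q (axis j 1) \<bullet> v i)\<bar>)"
        by (metis sum_abs)
      also have "\<dots> \<le> (\<Sum>i\<in>(UNIV::'n set). \<rho> * l $ j * \<gamma>)"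
      proof (rule sum_mono)
        fix i :: 'n
        show "\<bar>s i * (Q (axis j 1) \<bullet> v i)\<bar> \<le> \<rho> * l $ j * \<gamma>"
        proof (cases "i < j")
          case True
          have "0 \<le> \<gamma>"
            using v[of i] norm_ge_zero order_trans by blast
          then show ?thesis
            using True tri \<open>0 \<le> \<rho>\<close> l(1)[of j] by simp
        next
          case False
          have "\<bar>Q (axis j 1) \<bullet> v i\<bar> \<le> norm (Q (axis j 1)) * norm (v i)"
            by (rule Cauchy_Schwarz_ineq2)
          also have "\<dots> = norm (v i)"
            using orthogonal_transformation_norm[OF Q] by simp
          finally have "\<bar>Q (axis j 1) \<bullet> v i\<bar> \<le> \<gamma>"
            using v[of i] by linarith
          moreover have "\<bar>s i\<bar> \<le> \<rho> * l $ j"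
            using s[of i] l(2)[of j i] False \<open>0 \<le> \<rho>\<close> mult_left_mono[of "l $ i" "l $ j" \<rho>]
            by (simp add: not_less)
          ultimately show ?thesis
            unfolding abs_mult by (intro mult_mono) auto
        qed
      qed
      also have "\<dots> = real CARD('n) * \<rho> * \<gamma> * l $ j"
        by simp
      finally show ?thesis .
    qed
    with y show ?thesis by blast
  qed
  with Q that show ?thesis by blast
qed

section \<open>Covering by boxes\<close>

lemma box_cover_mono:
  assumes "box_cover F \<delta> \<B>" and "E \<subseteq> F"
  shows "box_cover E \<delta> \<B>"
  using assms unfolding box_cover_def by blast

text \<open>On the line, the intervals \<open>(k l/2, k l/2 + l)\<close> with \<open>\<bar>k\<bar> \<le> N\<close> cover \<open>[- R l, R l]\<close> once
  \<open>2 R + 1 \<le> N\<close>; their overlaps by half a length are needed because they are open.\<close>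

lemma box_cover_subdivide:
  fixes l \<delta> :: "real ^ 'n::{finite,linorder}" and N :: nat
  assumes Q: "orthogonal_transformation Q"
    and l: "\<And>i. 0 < l $ i" "\<And>i j. i \<le> j \<Longrightarrow> l $ j \<le> l $ i" "\<And>i. l $ i \<le> \<delta> $ i"
    and N: "2 * R + 1 \<le> real N"
  shows "\<exists>\<C>. finite \<C> \<and> card \<C> \<le> (2 * N + 1) ^ CARD('n) \<and>
    box_cover ((\<lambda>y. p + Q y) ` {y. \<forall>j. \<bar>y $ j\<bar> \<le> R * l $ j}) \<delta> \<C>"
proof -
  have lin: "linear Q"
    using Q by (simp add: orthogonal_transformation_def)
  define corner :: "('n \<Rightarrow> int) \<Rightarrow> real ^ 'n::{finite,linorder}" where "corner k = (\<chi> i. of_int (k i) * l $ i / 2)" for k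
  define piece where "piece k = (\<lambda>x. (p + Q (corner k)) + Q x) ` {x. \<forall>i. 0 < x $ i \<and> x $ i < l $ i}" for k
  define I :: "('n \<Rightarrow> int) set" where "I = UNIV \<rightarrow>\<^sub>E {- int N..int N}"
  have "finite I"
    unfolding I_def by (intro finite_PiE) auto
  have "card I = (2 * N + 1) ^ CARD('n)"
    unfolding I_def by (simp add: card_funcsetE nat_add_distrib nat_mult_distrib)
  then have "card (piece ` I) \<le> (2 * N + 1) ^ CARD('n)"
    using card_image_le[OF \<open>finite I\<close>, of piece] by simp
  moreover have "box_cover ((\<lambda>y. p + Q y) ` {y. \<forall>j. \<bar>y $ j\<bar> \<le> R * l $ j}) \<delta> (piece ` I)"
    unfolding box_cover_def
  proof (intro conjI ballI subsetI)
    fix z assume "z \<in> (\<lambda>y. p + Q y) ` {y. \<forall>j. \<bar>y $ j\<bar> \<le> R * l $ j}"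
    then obtain y where z: "z = p + Q y" and y: "\<And>j. \<bar>y $ j\<bar> \<le> R * l $ j"
      by blast
    \<comment> \<open>The least \<open>k\<close> with \<open>y $ j \<le> (k + 1) * l $ j / 2\<close>, so \<open>y $ j\<close> lies in the left half of its
      interval, the midpoint included.\<close>
    define k where "k j = \<lceil>2 * y $ j / l $ j\<rceil> - 1" for j
    have k1: "of_int (k j) < 2 * y $ j / l $ j" and k2: "2 * y $ j / l $ j \<le> of_int (k j) + 1" for j
      unfolding k_def by linarith+
    have "\<bar>y $ j / l $ j\<bar> \<le> R" for j
      using y[of j] l(1)[of j] by (simp add: abs_divide pos_divide_le_eq)
    then have bnd: "\<bar>2 * y $ j / l $ j\<bar> \<le> 2 * R" for j
      by (simp add: abs_mult flip: times_divide_eq_right)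
    have "k j \<in> {- int N..int N}" for j
    proof -
      have "real_of_int (k j) \<le> real N" and "- real N \<le> real_of_int (k j)"
        using k1[of j] k2[of j] abs_le_D1[OF bnd[of j]] abs_le_D2[OF bnd[of j]] N by linarith+
      then have "k j \<le> int N" and "- int N \<le> k j"
        by linarith+
      then show ?thesis
        by simp
    qed
    then have "k \<in> I"
      by (auto simp: I_def)
    moreover have "z \<in> piece k"
    proof -
      have "z = (p + Q (corner k)) + Q (y - corner k)"
        by (simp add: z linear_diff[OF lin])
      moreover have "0 < (y - corner k) $ i \<and> (y - corner k) $ i < l $ i" for i
        using k1[of i] k2[of i] l(1)[of i] by (simp add: corner_def field_simps)
      ultimately show ?thesis
        unfolding piece_def by blast
    qed
    ultimately show "z \<in> \<Union> (piece ` I)"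
      by blast
  next
    fix B assume "B \<in> piece ` I"
    then obtain k where "B = piece k"
      by blast
    then have "open_box_sides B l"
      unfolding open_box_sides_def piece_def using l Q by blast
    with l(3) show "\<exists>l. open_box_sides B l \<and> (\<forall>i. l $ i \<le> \<delta> $ i)"
      by blast
  qed
  ultimately show ?thesis
    using \<open>finite I\<close> by blast
qed

lemma cover_number_le:
  assumes "finite \<B>" and "box_cover F \<delta> \<B>"
  shows "cover_number F \<delta> \<le> card \<B>"
  unfolding cover_number_def by (rule Least_le) (use assms in blast)

text \<open>A finite cover exists because the smallest entry of \<open>\<delta>\<close> is positive: a bounded set lies in
  \<open>{y. \<forall>j. \<bar>y $ j\<bar> \<le> R * \<delta> $ j}\<close> for \<open>R\<close> large, and this box can be subdivided.\<close>

lemma cover_number_attained: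
  fixes F :: "(real ^ 'n::{finite,linorder}) set"
  assumes "bounded F" and \<delta>: "\<delta> \<in> scales"
  obtains \<B> where "finite \<B>" and "card \<B> = cover_number F \<delta>" and "box_cover F \<delta> \<B>"
proof -
  obtain r where r: "\<And>x. x \<in> F \<Longrightarrow> norm x \<le> r"
    using assms(1) by (auto simp: bounded_iff)
  define m where "m = Min (range (($) \<delta>))"
  have \<delta>pos: "0 < \<delta> $ i" for i
    using \<delta> by (simp add: scales_def)
  have "0 < m"
    unfolding m_def using \<delta>pos by (subst Min_gr_iff) auto
  have m: "m \<le> \<delta> $ j" for j
    unfolding m_def by (intro Min_le) auto
  define R where "R = \<bar>r\<bar> / m"
  have "F \<subseteq> (\<lambda>y. 0 + id y) ` {y. \<forall>j. \<bar>y $ j\<bar> \<le> R * \<delta> $ j}"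
  proof
    fix x assume "x \<in> F"
    have "\<bar>x $ j\<bar> \<le> R * \<delta> $ j" for j
    proof -
      have "\<bar>x $ j\<bar> \<le> \<bar>r\<bar>"
        using component_le_norm_cart[of x j] r[OF \<open>x \<in> F\<close>] by linarith
      also have "\<dots> = R * m"
        using \<open>0 < m\<close> by (simp add: R_def)
      also have "\<dots> \<le> R * \<delta> $ j"
        using m \<open>0 < m\<close> by (intro mult_left_mono) (auto simp: R_def)
      finally show ?thesis .
    qed
    then show "x \<in> (\<lambda>y. 0 + id y) ` {y. \<forall>j. \<bar>y $ j\<bar> \<le> R * \<delta> $ j}"
      by auto
  qed
  moreover obtain N :: nat where N: "2 * R + 1 \<le> real N"
    using real_arch_simple by blast
  have "\<exists>\<C>. finite \<C> \<and> card \<C> \<le> (2 * N + 1) ^ CARD('n) \<and>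
      box_cover ((\<lambda>y. 0 + id y) ` {y. \<forall>j. \<bar>y $ j\<bar> \<le> R * \<delta> $ j}) \<delta> \<C>"
    using \<delta> N by (intro box_cover_subdivide orthogonal_transformation_id) (auto simp: scales_def)
  ultimately have "\<exists>k \<C>. finite \<C> \<and> card \<C> = k \<and> box_cover F \<delta> \<C>"
    using box_cover_mono by blast
  then have "\<exists>\<C>. finite \<C> \<and> card \<C> = cover_number F \<delta> \<and> box_cover F \<delta> \<C>"
    unfolding cover_number_def by (rule LeastI_ex)
  then show ?thesis
    using that by blast
qed

section \<open>Distortion of boxes and covering numbers\<close>

text \<open>Write the increments from a base point \<open>x0\<close> in the axes of the box and apply \<open>proj_map_diff\<close>.
  The point \<open>x0\<close> has to be taken in \<open>B \<inter> K\<close>, since the box itself may leave the domain; this is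
  also why only \<open>B \<inter> K\<close> is mapped.  The same \<open>R\<close> works for every box because the linear maps at the
  points \<open>x0\<close> of \<open>K\<close> and the factors \<open>1 / proj_denom P x\<close> are bounded on \<open>K\<close>.\<close>

lemma proj_image_box:
  fixes P :: "real ^ ('n + unit) ^ ('n::{finite,linorder} + unit)"
  assumes "compact K" and "K \<subseteq> proj_dom P"
  obtains R where
    "\<And>B l. open_box_sides B l \<Longrightarrow> \<exists>p Q. orthogonal_transformation Q \<and>
      proj_map P ` (B \<inter> K) \<subseteq> (\<lambda>y. p + Q y) ` {y. \<forall>j. \<bar>y $ j\<bar> \<le> R * l $ j}"
proof -
  have nz: "proj_denom P x \<noteq> 0" if "x \<in> K" for x
    using assms(2) that by (auto simp: proj_dom_def)
  have "compact ((\<lambda>x. 1 / proj_denom P x) ` K)"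
    by (intro compact_continuous_image assms continuous_intros continuous_on_proj_denom) (use nz in auto)
  then obtain \<beta> where \<beta>: "0 < \<beta>" "\<And>x. x \<in> K \<Longrightarrow> \<bar>1 / proj_denom P x\<bar> \<le> \<beta>"
    using bounded_pos[of "(\<lambda>x. 1 / proj_denom P x) ` K"] compact_imp_bounded by auto
  have "compact (proj_map P ` K)"
    by (intro compact_continuous_image assms continuous_on_proj_map)
  then obtain \<tau> where \<tau>: "\<And>x. x \<in> K \<Longrightarrow> norm (proj_map P x) \<le> \<tau>"
    using bounded_iff[of "proj_map P ` K"] compact_imp_bounded by auto
  obtain a where a: "\<And>h. norm (linear_part P *v h) \<le> norm h * a"
    using bounded_linear.bounded[OF matrix_vector_mul_bounded_linear[of "linear_part P"]] by blast
  define \<gamma> where "\<gamma> = a + norm (denom_gradient P) * \<tau>"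
  have "\<exists>p Q. orthogonal_transformation Q \<and>
      proj_map P ` (B \<inter> K) \<subseteq> (\<lambda>y. p + Q y) ` {y. \<forall>j. \<bar>y $ j\<bar> \<le> real CARD('n) * \<beta> * \<gamma> * l $ j}"
    if "open_box_sides B l" for B l
  proof (cases "B \<inter> K = {}")
    case True
    then show ?thesis
      by (auto intro: exI[of _ id] orthogonal_transformation_id)
  next
    case False
    then obtain x0 where x0: "x0 \<in> B" "x0 \<in> K"
      by blast
    obtain o0 Q0 where l: "\<And>i. 0 < l $ i" "\<And>i j. i \<le> j \<Longrightarrow> l $ j \<le> l $ i"
      and Q0: "orthogonal_transformation Q0"
      and B: "B = (\<lambda>x. o0 + Q0 x) ` {x. \<forall>i. 0 < x $ i \<and> x $ i < l $ i}"
      using \<open>open_box_sides B l\<close> unfolding open_box_sides_def by blast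
    have lin0: "linear Q0"
      using Q0 by (simp add: orthogonal_transformation_def)
    define L where "L h = linear_part P *v h - (denom_gradient P \<bullet> h) *\<^sub>R proj_map P x0" for h
    have linL: "linear L"
      by (intro linearI)
        (simp_all add: L_def matrix_vector_right_distrib matrix_vector_mult_scaleR inner_add_right algebra_simps)
    \<comment> \<open>The images of the axes of the box under the linear part at \<open>x0\<close>; as in the box, their order is
      the order of decreasing sides.\<close>
    define v where "v i = L (Q0 (axis i 1))" for i
    have v: "norm (v i) \<le> \<gamma>" for i
    proof -
      let ?e = "Q0 (axis i 1)"
      have e: "norm ?e = 1"
        using orthogonal_transformation_norm[OF Q0] by simp
      have "norm (v i) \<le> norm (linear_part P *v ?e) + \<bar>denom_gradient P \<bullet> ?e\<bar> * norm (proj_map P x0)"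
        using norm_triangle_ineq4[of "linear_part P *v ?e" "(denom_gradient P \<bullet> ?e) *\<^sub>R proj_map P x0"]
        by (simp add: v_def L_def)
      also have "\<dots> \<le> a + norm (denom_gradient P) * \<tau>"
        using a[of ?e] Cauchy_Schwarz_ineq2[of "denom_gradient P" ?e] \<tau>[OF x0(2)] e
        by (intro add_mono mult_mono) auto
      finally show ?thesis
        by (simp add: \<gamma>_def)
    qed
    obtain Q :: "real ^ 'n::{finite,linorder} \<Rightarrow> real ^ 'n::{finite,linorder}" where Q: "orthogonal_transformation Q"
      and comb: "\<forall>s. (\<forall>i. \<bar>s i\<bar> \<le> \<beta> * l $ i) \<longrightarrow>
        (\<exists>y. (\<Sum>i\<in>UNIV. s i *\<^sub>R v i) = Q y \<and> (\<forall>j. \<bar>y $ j\<bar> \<le> real CARD('n) * \<beta> * \<gamma> * l $ j))"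
      using combination_in_oriented_box[of v \<gamma> l \<beta>, OF v l less_imp_le[OF \<beta>(1)]] by blast
    have "proj_map P x \<in> (\<lambda>y. proj_map P x0 + Q y) ` {y. \<forall>j. \<bar>y $ j\<bar> \<le> real CARD('n) * \<beta> * \<gamma> * l $ j}"
      if x: "x \<in> B" "x \<in> K" for x
    proof -
      obtain u where u: "x = o0 + Q0 u" "\<And>i. 0 < u $ i \<and> u $ i < l $ i"
        using x(1) unfolding B by blast
      obtain u0 where u0: "x0 = o0 + Q0 u0" "\<And>i. 0 < u0 $ i \<and> u0 $ i < l $ i"
        using x0(1) unfolding B by blast
      define t where "t = u - u0"
      have t: "\<bar>t $ i\<bar> \<le> l $ i" for i
        using u(2)[of i] u0(2)[of i] by (auto simp: t_def)
      have "L (x - x0) = L (Q0 t)"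
        by (simp add: u(1) u0(1) t_def linear_diff[OF lin0])
      also have "t = (\<Sum>i\<in>UNIV. t $ i *\<^sub>R axis i 1)"
        using basis_expansion[of t] by (simp only: scalar_mult_eq_scaleR)
      also have "L (Q0 \<dots>) = (\<Sum>i\<in>UNIV. t $ i *\<^sub>R v i)"
        by (simp add: linear_sum[OF lin0] linear_sum[OF linL] linear_cmul[OF lin0] linear_cmul[OF linL] v_def)
      finally have Lt: "L (x - x0) = (\<Sum>i\<in>UNIV. t $ i *\<^sub>R v i)" .
      define s where "s i = 1 / proj_denom P x * t $ i" for i
      have "\<bar>s i\<bar> \<le> \<beta> * l $ i" for i
        unfolding s_def abs_mult using \<beta>(2)[OF x(2)] t[of i] \<beta>(1) by (intro mult_mono) auto
      then obtain y where y: "(\<Sum>i\<in>UNIV. s i *\<^sub>R v i) = Q y"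
        "\<forall>j. \<bar>y $ j\<bar> \<le> real CARD('n) * \<beta> * \<gamma> * l $ j"
        using comb by blast
      have "proj_map P x - proj_map P x0 = (1 / proj_denom P x) *\<^sub>R L (x - x0)"
        unfolding L_def using nz x(2) x0(2) by (intro proj_map_diff) auto
      also have "\<dots> = (\<Sum>i\<in>UNIV. s i *\<^sub>R v i)"
        unfolding Lt s_def by (simp add: scaleR_sum_right)
      finally have "proj_map P x = proj_map P x0 + Q y"
        unfolding y(1) by (simp add: algebra_simps)
      with y(2) show ?thesis by blast
    qed
    with Q show ?thesis by blast
  qed
  with that show ?thesis by blast
qed

lemma cover_number_proj_image_le:
  fixes P :: "real ^ ('n + unit) ^ ('n::{finite,linorder} + unit)"
  assumes "compact K" and "K \<subseteq> proj_dom P"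
  obtains C :: nat where "C \<ge> 1"
    and "\<And>F \<delta>. F \<subseteq> K \<Longrightarrow> \<delta> \<in> scales \<Longrightarrow>
      cover_number (proj_map P ` F) \<delta> \<le> C * cover_number F \<delta>"
proof -
  obtain R where R: "\<And>B l. open_box_sides B l \<Longrightarrow> \<exists>p Q. orthogonal_transformation Q \<and>
      proj_map P ` (B \<inter> K) \<subseteq> (\<lambda>y. p + Q y) ` {y. \<forall>j. \<bar>y $ j\<bar> \<le> R * l $ j}"
    using proj_image_box[OF assms] by blast
  obtain N :: nat where N: "2 * R + 1 \<le> real N"
    using real_arch_simple by blast
  define C where "C = (2 * N + 1) ^ CARD('n)"
  have "cover_number (proj_map P ` F) \<delta> \<le> C * cover_number F \<delta>"
    if FK: "F \<subseteq> K" and \<delta>: "\<delta> \<in> scales" for F \<delta>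
  proof -
    have "bounded F"
      using FK assms(1) bounded_subset compact_imp_bounded by blast
    then obtain \<B> where \<B>: "finite \<B>" "card \<B> = cover_number F \<delta>" "box_cover F \<delta> \<B>"
      using cover_number_attained \<delta> by blast
    have "\<exists>\<C>. finite \<C> \<and> card \<C> \<le> C \<and> box_cover (proj_map P ` (B \<inter> K)) \<delta> \<C>" if B: "B \<in> \<B>" for B
    proof -
      obtain l where l: "open_box_sides B l" "\<And>i. l $ i \<le> \<delta> $ i"
        using \<B>(3) B unfolding box_cover_def by blast
      obtain p Q where Q: "orthogonal_transformation Q"
        "proj_map P ` (B \<inter> K) \<subseteq> (\<lambda>y. p + Q y) ` {y. \<forall>j. \<bar>y $ j\<bar> \<le> R * l $ j}"
        using R[OF l(1)] by blast
      have "\<exists>\<C>. finite \<C> \<and> card \<C> \<le> (2 * N + 1) ^ CARD('n) \<and>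
          box_cover ((\<lambda>y. p + Q y) ` {y. \<forall>j. \<bar>y $ j\<bar> \<le> R * l $ j}) \<delta> \<C>"
        using l N Q(1) by (intro box_cover_subdivide) (auto simp: open_box_sides_def)
      then show ?thesis
        unfolding C_def using box_cover_mono[OF _ Q(2)] by blast
    qed
    then obtain \<C> where \<C>: "\<And>B. B \<in> \<B> \<Longrightarrow> finite (\<C> B)" "\<And>B. B \<in> \<B> \<Longrightarrow> card (\<C> B) \<le> C"
      "\<And>B. B \<in> \<B> \<Longrightarrow> box_cover (proj_map P ` (B \<inter> K)) \<delta> (\<C> B)"
      by metis
    have "F \<subseteq> (\<Union>B\<in>\<B>. B \<inter> K)"
      using \<B>(3) FK unfolding box_cover_def by blast
    then have "box_cover (proj_map P ` F) \<delta> (\<Union>B\<in>\<B>. \<C> B)"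
      using \<C>(3) unfolding box_cover_def by blast
    then have "cover_number (proj_map P ` F) \<delta> \<le> card (\<Union>B\<in>\<B>. \<C> B)"
      using \<B>(1) \<C>(1) by (intro cover_number_le) auto
    also have "\<dots> \<le> (\<Sum>B\<in>\<B>. card (\<C> B))"
      by (rule card_UN_le[OF \<B>(1)])
    also have "\<dots> \<le> (\<Sum>B\<in>\<B>. C)"
      by (intro sum_mono \<C>(2))
    also have "\<dots> = C * cover_number F \<delta>"
      by (simp add: \<B>(2))
    finally show ?thesis .
  qed
  moreover have "C \<ge> 1"
    by (simp add: C_def)
  ultimately show ?thesis
    using that by blast
qed

section \<open>Box dimension prints\<close>

text \<open>Positivity of a lower or upper limit survives multiplication by a positive constant.  The case
  of a trivial filter is separate because there a lower limit is \<open>\<infinity>\<close> and an upper limit \<open>- \<infinity>\<close>, for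
  every function.\<close>

lemma prints_mono:
  fixes F G :: "(real ^ 'n::{finite,linorder}) set"
  assumes "0 < C"
    and le: "\<And>\<delta>. \<delta> \<in> scales \<Longrightarrow> real (cover_number F \<delta>) \<le> C * real (cover_number G \<delta>)"
  shows "lower_print F \<subseteq> lower_print G" and "upper_print F \<subseteq> upper_print G"
proof -
  let ?f = "\<lambda>\<alpha> \<delta>. ereal (real (cover_number F \<delta>) * scale_power \<delta> \<alpha>)"
  let ?g = "\<lambda>\<alpha> \<delta>. ereal (real (cover_number G \<delta>) * scale_power \<delta> \<alpha>)"
  have ev: "eventually (\<lambda>\<delta>. ?f \<alpha> \<delta> \<le> ereal C * ?g \<alpha> \<delta>) scales_to_zero" for \<alpha>
  proof -
    have "?f \<alpha> \<delta> \<le> ereal C * ?g \<alpha> \<delta>" if "\<delta> \<in> scales" for \<delta>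
    proof -
      have "0 \<le> scale_power \<delta> \<alpha>"
        unfolding scale_power_def by (intro prod_nonneg) simp
      then show ?thesis
        using mult_right_mono[OF le[OF that]] by (simp add: mult.assoc)
    qed
    then show ?thesis
      unfolding scales_to_zero_def by (simp add: eventually_inf_principal)
  qed
  have "Liminf scales_to_zero (?g \<alpha>) > 0" if "Liminf scales_to_zero (?f \<alpha>) > 0" for \<alpha>
  proof (cases "scales_to_zero = (bot :: (real ^ 'n::{finite,linorder}) filter)")
    case False
    have "0 < ereal C * Liminf scales_to_zero (?g \<alpha>)"
      using less_le_trans[OF that Liminf_mono[OF ev]] Liminf_ereal_mult_left[OF False, of C "?g \<alpha>"] assms(1)
      by simp
    then show ?thesis
      using assms(1) by (auto simp: ereal_zero_less_0_iff)
  qed (simp add: top_ereal_def)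
  then show "lower_print F \<subseteq> lower_print G"
    by (auto simp: lower_print_def)
  have "Limsup scales_to_zero (?g \<alpha>) > 0" if "Limsup scales_to_zero (?f \<alpha>) > 0" for \<alpha>
  proof (cases "scales_to_zero = (bot :: (real ^ 'n::{finite,linorder}) filter)")
    case False
    have "0 < ereal C * Limsup scales_to_zero (?g \<alpha>)"
      using less_le_trans[OF that Limsup_mono[OF ev]] Limsup_ereal_mult_left[OF False, of C "?g \<alpha>"] assms(1)
      by simp
    then show ?thesis
      using assms(1) by (auto simp: ereal_zero_less_0_iff)
  qed (use that in simp)
  then show "upper_print F \<subseteq> upper_print G"
    by (auto simp: upper_print_def)
qed

section \<open>Projective invariance\<close>

text \<open>The reverse inequality is the estimate for the inverse map on the compact set \<open>proj_map P ` K\<close>, which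
  lies in the domain of the inverse.\<close>

lemma cover_number_proj_comparable:
  fixes P P' :: "real ^ ('n + unit) ^ ('n::{finite,linorder} + unit)"
  assumes "compact K" and "K \<subseteq> proj_dom P" and inv: "P' ** P = mat 1"
  obtains C :: real where "C \<ge> 1"
    and "\<And>F \<delta>. F \<subseteq> K \<Longrightarrow> \<delta> \<in> scales \<Longrightarrow>
      real (cover_number (proj_map P ` F) \<delta>) \<le> C * real (cover_number F \<delta>)"
    and "\<And>F \<delta>. F \<subseteq> K \<Longrightarrow> \<delta> \<in> scales \<Longrightarrow>
      real (cover_number F \<delta>) \<le> C * real (cover_number (proj_map P ` F) \<delta>)"
proof -
  have nz: "proj_denom P x \<noteq> 0" if "x \<in> K" for x
    using assms(2) that by (auto simp: proj_dom_def)
  obtain C1 where C1: "C1 \<ge> 1" "\<And>F \<delta>. F \<subseteq> K \<Longrightarrow> \<delta> \<in> scales \<Longrightarrow>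
      cover_number (proj_map P ` F) \<delta> \<le> C1 * cover_number F \<delta>"
    using cover_number_proj_image_le[OF assms(1,2)] by blast
  have "compact (proj_map P ` K)"
    by (intro compact_continuous_image assms continuous_on_proj_map)
  moreover have "proj_map P ` K \<subseteq> proj_dom P'"
    using proj_map_inverse(1)[OF inv nz] by (auto simp: proj_dom_def)
  ultimately obtain C2 where C2: "C2 \<ge> 1" "\<And>F \<delta>. F \<subseteq> proj_map P ` K \<Longrightarrow> \<delta> \<in> scales \<Longrightarrow>
      cover_number (proj_map P' ` F) \<delta> \<le> C2 * cover_number F \<delta>"
    using cover_number_proj_image_le by blast
  let ?C = "max C1 C2"
  have fwd: "cover_number (proj_map P ` F) \<delta> \<le> ?C * cover_number F \<delta>"
    if "F \<subseteq> K" "\<delta> \<in> scales" for F \<delta>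
    using C1(2)[OF that] by (rule order_trans) (intro mult_right_mono, auto)
  have bwd: "cover_number F \<delta> \<le> ?C * cover_number (proj_map P ` F) \<delta>"
    if "F \<subseteq> K" "\<delta> \<in> scales" for F \<delta>
  proof -
    have "proj_map P' ` proj_map P ` F = F"
      using that(1) proj_map_inverse(2)[OF inv nz] by (force simp: image_image)
    then have "cover_number F \<delta> \<le> C2 * cover_number (proj_map P ` F) \<delta>"
      using C2(2)[of "proj_map P ` F" \<delta>] that by (simp add: image_mono)
    also have "\<dots> \<le> ?C * cover_number (proj_map P ` F) \<delta>"
      by (intro mult_right_mono) auto
    finally show ?thesis .
  qed
  show ?thesis
  proof (rule that[of "real ?C"])
    show "real ?C \<ge> 1"
      using C1(1) by simp
  qed (metis fwd of_nat_le_iff of_nat_mult, metis bwd of_nat_le_iff of_nat_mult)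
qed

theorem theorem3p6:
  fixes A :: "real ^ 'n::{finite,linorder} ^ 'n::{finite,linorder}"
    and b c :: "real ^ 'n::{finite,linorder}"
    and d :: real
    and M :: "real ^ ('n + unit) ^ ('n + unit)"
    and q :: "real ^ 'n::{finite,linorder} \<Rightarrow> real"
  assumes "M = block_matrix A b c d"
    and "invertible M"
    and "\<And>x. q x = c \<bullet> x + d"
  shows "\<exists>C :: (real ^ 'n::{finite,linorder}) set \<Rightarrow> real.
    \<forall>(U :: (real ^ 'n::{finite,linorder}) set) V
      (T :: real ^ 'n::{finite,linorder} \<Rightarrow> real ^ 'n::{finite,linorder}).
      open U \<and> U \<noteq> {} \<and> (\<forall>x\<in>U. q x \<noteq> 0) \<and>
      (\<forall>x\<in>U. T x = (1 / q x) *\<^sub>R (A *v x + b)) \<and> V = T ` U \<longrightarrow>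
        bij_betw T U V \<and>
        V \<subseteq> proj_dom (matrix_inv M) \<and>
        (\<forall>z\<in>V. the_inv_into U T z = proj_map (matrix_inv M) z) \<and>
        (\<forall>K. compact K \<and> K \<noteq> {} \<and> K \<subseteq> U \<longrightarrow>
          C K \<ge> 1 \<and>
          (\<forall>F. F \<noteq> {} \<and> F \<subseteq> K \<longrightarrow>
            (\<forall>\<delta>\<in>scales.
              inverse (C K) * real (cover_number F \<delta>) \<le> real (cover_number (T ` F) \<delta>) \<and>
              real (cover_number (T ` F) \<delta>) \<le> C K * real (cover_number F \<delta>)) \<and>
            lower_print (T ` F) = lower_print F \<and>
            upper_print (T ` F) = upper_print F))"
proof -
  let ?M' = "matrix_inv M"
  have inv: "?M' ** M = mat 1"
    using assms(2) unfolding invertible_def matrix_inv_def by (rule someI2_ex) simp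
  have den: "proj_denom M x = q x" for x
    by (simp add: assms(1,3) proj_denom_block_matrix)
  define good where "good K C \<longleftrightarrow> C \<ge> 1 \<and> (\<forall>F \<delta>. F \<subseteq> K \<longrightarrow> \<delta> \<in> scales \<longrightarrow>
      real (cover_number (proj_map M ` F) \<delta>) \<le> C * real (cover_number F \<delta>) \<and>
      real (cover_number F \<delta>) \<le> C * real (cover_number (proj_map M ` F) \<delta>))" for K C
  \<comment> \<open>The constant is chosen from \<open>K\<close> alone, since on any admissible \<open>U\<close> the map \<open>T\<close> is \<open>proj_map M\<close>.\<close>
  define C where "C K = (SOME C. good K C)" for K
  have C: "good K (C K)" if "compact K" "\<forall>x\<in>K. q x \<noteq> 0" for K
  proof -
    have "K \<subseteq> proj_dom M"
      using that(2) by (auto simp: proj_dom_def den)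
    then have "\<exists>C. good K C"
      unfolding good_def using cover_number_proj_comparable[OF that(1) _ inv] by metis
    then show ?thesis
      unfolding C_def by (rule someI_ex)
  qed
  show ?thesis
  proof (intro exI[of _ C] allI impI, elim conjE)
    fix U V :: "(real ^ 'n::{finite,linorder}) set" and T :: "real ^ 'n::{finite,linorder} \<Rightarrow> real ^ 'n::{finite,linorder}"
    assume q: "\<forall>x\<in>U. q x \<noteq> 0" and Tq: "\<forall>x\<in>U. T x = (1 / q x) *\<^sub>R (A *v x + b)" and V: "V = T ` U"
    have T: "T x = proj_map M x" if "x \<in> U" for x
      using Tq that by (simp add: assms(1,3) proj_map_block_matrix)
    have T1: "proj_denom ?M' (T x) \<noteq> 0" and T2: "proj_map ?M' (T x) = x" if "x \<in> U" for x
      using proj_map_inverse[OF inv, of x] q T[OF that] that by (auto simp: den)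
    have "inj_on T U"
      by (rule inj_on_inverseI[of _ "proj_map ?M'"]) (rule T2)
    then have "bij_betw T U V"
      by (simp add: V bij_betw_def)
    moreover have "V \<subseteq> proj_dom ?M'"
      using T1 by (auto simp: V proj_dom_def)
    moreover have "\<forall>z\<in>V. the_inv_into U T z = proj_map ?M' z"
      using T2 by (auto simp: V the_inv_into_f_f[OF \<open>inj_on T U\<close>])
    moreover have "C K \<ge> 1 \<and> (\<forall>F. F \<noteq> {} \<and> F \<subseteq> K \<longrightarrow>
        (\<forall>\<delta>\<in>scales.
          inverse (C K) * real (cover_number F \<delta>) \<le> real (cover_number (T ` F) \<delta>) \<and>
          real (cover_number (T ` F) \<delta>) \<le> C K * real (cover_number F \<delta>)) \<and>
        lower_print (T ` F) = lower_print F \<and> upper_print (T ` F) = upper_print F)"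
      if "compact K" "K \<subseteq> U" for K
    proof -
      have g: "good K (C K)"
        using C that q by blast
      then have C1: "C K \<ge> 1"
        by (simp add: good_def)
      have "(\<forall>\<delta>\<in>scales.
          inverse (C K) * real (cover_number F \<delta>) \<le> real (cover_number (T ` F) \<delta>) \<and>
          real (cover_number (T ` F) \<delta>) \<le> C K * real (cover_number F \<delta>)) \<and>
        lower_print (T ` F) = lower_print F \<and> upper_print (T ` F) = upper_print F" if "F \<subseteq> K" for F
      proof -
        have TF: "T ` F = proj_map M ` F"
          using T that \<open>K \<subseteq> U\<close> by (intro image_cong) auto
        have up: "real (cover_number (T ` F) \<delta>) \<le> C K * real (cover_number F \<delta>)"
          and lo: "real (cover_number F \<delta>) \<le> C K * real (cover_number (T ` F) \<delta>)"
          if "\<delta> \<in> scales" for \<delta>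
          using g that \<open>F \<subseteq> K\<close> unfolding good_def TF by blast+
        have "inverse (C K) * real (cover_number F \<delta>) \<le> real (cover_number (T ` F) \<delta>)"
          if "\<delta> \<in> scales" for \<delta>
          using lo[OF that] C1 by (simp add: field_simps)
        moreover have "0 < C K"
          using C1 by simp
        ultimately show ?thesis
          using up prints_mono[OF \<open>0 < C K\<close> up] prints_mono[OF \<open>0 < C K\<close> lo] by blast
      qed
      with C1 show ?thesis by blast
    qed
    ultimately show "bij_betw T U V \<and>
        V \<subseteq> proj_dom ?M' \<and>
        (\<forall>z\<in>V. the_inv_into U T z = proj_map ?M' z) \<and>
        (\<forall>K. compact K \<and> K \<noteq> {} \<and> K \<subseteq> U \<longrightarrow>
          C K \<ge> 1 \<and>
          (\<forall>F. F \<noteq> {} \<and> F \<subseteq> K \<longrightarrow>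
            (\<forall>\<delta>\<in>scales.
              inverse (C K) * real (cover_number F \<delta>) \<le> real (cover_number (T ` F) \<delta>) \<and>
              real (cover_number (T ` F) \<delta>) \<le> C K * real (cover_number F \<delta>)) \<and>
            lower_print (T ` F) = lower_print F \<and>
            upper_print (T ` F) = upper_print F))"
      by blast
  qed
qed

end
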